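(* There is an algorithm which, given a social network $(G,P,p,\theta)$ with $n$ nodes and a product $top\in P$, determines in time $O(n^2)$ whether the social network $(G,P,[top],\theta)$ is reachable from $(G,P,p,\theta)$, where $[top]$ denotes the constant function assigning $\{top\}$ to every node of $G$.
   Context: Setting. $G=(V,E)$ is a finite weighted directed graph with no parallel edges and no self-loops, $n=|V|$, and each edge $(i,j)$ has a weight $w_{ij}\in[0,1]$. For a node $i$, $N(i)$ is the set of nodes $j$ with an edge $(j,i)\in E$ (the neighbours of $i$). It is assumed that $\sum_{j\in N(i)} w_{ji}\le 1$ for every node $i$ with $N(i)\ne\emptyset$. The threshold function $\theta$ assigns to each node $i$ a value $\theta(i)\in(0,1]$. $P$ is a finite set of products. A social network is a tuple $(G,P,p,\theta)$ where $p$ assigns to each node a non-empty subset of $P$; since $G,P,\theta$ are fixed, a social network is identified with $p$. Reductions. For a product $t$ and a node $i$, the adoption condition $A(t,i)$ holds in $p$ if $N(i)=\emptyset$, or if $N(i)\neq\emptyset$ and $\sum_{j\in N(i)\mid p(j)=\{t\}} w_{ji}\ge\theta(i)$. Write $p_1\to p_2$ if $p_2\ne p_1$ and for all nodes $i$ with $p_2(i)\ne p_1(i)$ we have $|p_1(i)|\ge 2$ and, for some $t\in p_1(i)$, $p_2(i)=\{t\}$ and $A(t,i)$ holds in $p_1$. Let $\to^*$ be the reflexive, transitive closure of $\to$. A network $p'$ is reachable from $p$ if $p\to^* p'$. *)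

theory Defs
  imports Complex_Main "HOL-Library.FuncSet" "HOL-Library.Landau_Symbols"
begin

section \<open>Social networks\<close>

text \<open>Edges form a set of ordered pairs, so there are no parallel edges. The values of
  \<open>weight\<close> off the edges and of \<open>threshold\<close> off the nodes are irrelevant.\<close>

record ('v, 'p) setting =
  nodes :: "'v set"
  edges :: "('v \<times> 'v) set"
  weight :: "'v \<Rightarrow> 'v \<Rightarrow> real"
  threshold :: "'v \<Rightarrow> real"
  products :: "'p set"

definition neighbours :: "('v, 'p) setting \<Rightarrow> 'v \<Rightarrow> 'v set" where
  "neighbours G i = {j. (j, i) \<in> edges G}"

definition valid_setting :: "('v, 'p) setting \<Rightarrow> bool" where
  "valid_setting G \<longleftrightarrow>
     finite (nodes G) \<and> finite (products G) \<and>
     edges G \<subseteq> nodes G \<times> nodes G \<and> (\<forall>i. (i, i) \<notin> edges G) \<and>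
     (\<forall>(i, j) \<in> edges G. 0 \<le> weight G i j \<and> weight G i j \<le> 1) \<and>
     (\<forall>i \<in> nodes G. neighbours G i \<noteq> {} \<longrightarrow> (\<Sum>j \<in> neighbours G i. weight G j i) \<le> 1) \<and>
     (\<forall>i \<in> nodes G. 0 < threshold G i \<and> threshold G i \<le> 1)"

text \<open>Product assignments are extensional functions, so that equality of functions is
  equality on the nodes.\<close>

definition social_networks :: "('v, 'p) setting \<Rightarrow> ('v \<Rightarrow> 'p set) set" where
  "social_networks G = nodes G \<rightarrow>\<^sub>E (Pow (products G) - {{}})"

definition const_network :: "('v, 'p) setting \<Rightarrow> 'p \<Rightarrow> 'v \<Rightarrow> 'p set" where
  "const_network G t = (\<lambda>i \<in> nodes G. {t})"

definition adoption :: "('v, 'p) setting \<Rightarrow> ('v \<Rightarrow> 'p set) \<Rightarrow> 'p \<Rightarrow> 'v \<Rightarrow> bool" where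
  "adoption G p t i \<longleftrightarrow>
     neighbours G i = {} \<or>
     neighbours G i \<noteq> {} \<and>
       (\<Sum>j \<in> {j \<in> neighbours G i. p j = {t}}. weight G j i) \<ge> threshold G i"

definition reduces :: "('v, 'p) setting \<Rightarrow> ('v \<Rightarrow> 'p set) \<Rightarrow> ('v \<Rightarrow> 'p set) \<Rightarrow> bool" where
  "reduces G p1 p2 \<longleftrightarrow>
     p1 \<in> social_networks G \<and> p2 \<in> social_networks G \<and> p2 \<noteq> p1 \<and>
     (\<forall>i \<in> nodes G. p2 i \<noteq> p1 i \<longrightarrow>
        card (p1 i) \<ge> 2 \<and> (\<exists>t \<in> p1 i. p2 i = {t} \<and> adoption G p1 t i))"

definition reachable :: "('v, 'p) setting \<Rightarrow> ('v \<Rightarrow> 'p set) \<Rightarrow> ('v \<Rightarrow> 'p set) \<Rightarrow> bool" where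
  "reachable G p p' \<longleftrightarrow> (reduces G)\<^sup>*\<^sup>* p p'"


section \<open>Algorithms and their running time\<close>

text \<open>
  Algorithms are programs of a unit-cost random access machine, extended by exact real
  arithmetic because weights and thresholds are real numbers. The machine has
  integer and real registers, and integer and real arrays that can be
  accessed at the index held in an integer register; a program names registers and arrays by
  literals, so it uses only finitely many of them. The operations are deliberately weak:
  the integer operations are addition and truncated subtraction (no multiplication), reals can
  only be moved, added, subtracted and compared, the only real literal is 0, and there is no
  conversion between the two sorts.
\<close>

record state =
  ireg :: "nat \<Rightarrow> nat"
  rreg :: "nat \<Rightarrow> real"
  iarr :: "nat \<Rightarrow> nat \<Rightarrow> nat"
  rarr :: "nat \<Rightarrow> nat \<Rightarrow> real"

text \<open>The first argument of an instruction is the target register; for the two store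
  instructions, it is the array.\<close>

datatype instr =
    Skip
  | IConst nat nat
  | IAdd nat nat nat
  | ISub nat nat nat
  | ILoad nat nat nat
  | IStore nat nat nat
  | RZero nat
  | RAdd nat nat nat
  | RSub nat nat nat
  | RLoad nat nat nat
  | RStore nat nat nat

datatype test =
    ILess nat nat
  | IEq nat nat
  | RLess nat nat
  | REq nat nat

datatype prog =
    Instr instr
  | Seq prog prog
  | If test prog prog
  | While test prog

fun step :: "instr \<Rightarrow> state \<Rightarrow> state" where
  "step Skip s = s"
| "step (IConst x k) s = s\<lparr>ireg := (ireg s)(x := k)\<rparr>"
| "step (IAdd x y z) s = s\<lparr>ireg := (ireg s)(x := ireg s y + ireg s z)\<rparr>"
| "step (ISub x y z) s = s\<lparr>ireg := (ireg s)(x := ireg s y - ireg s z)\<rparr>"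
| "step (ILoad x a y) s = s\<lparr>ireg := (ireg s)(x := iarr s a (ireg s y))\<rparr>"
| "step (IStore a x y) s =
     s\<lparr>iarr := (iarr s)(a := (iarr s a)(ireg s x := ireg s y))\<rparr>"
| "step (RZero x) s = s\<lparr>rreg := (rreg s)(x := 0)\<rparr>"
| "step (RAdd x y z) s = s\<lparr>rreg := (rreg s)(x := rreg s y + rreg s z)\<rparr>"
| "step (RSub x y z) s = s\<lparr>rreg := (rreg s)(x := rreg s y - rreg s z)\<rparr>"
| "step (RLoad x a y) s = s\<lparr>rreg := (rreg s)(x := rarr s a (ireg s y))\<rparr>"
| "step (RStore a x y) s =
     s\<lparr>rarr := (rarr s)(a := (rarr s a)(ireg s x := rreg s y))\<rparr>"

fun holds :: "test \<Rightarrow> state \<Rightarrow> bool" where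
  "holds (ILess x y) s \<longleftrightarrow> ireg s x < ireg s y"
| "holds (IEq x y) s \<longleftrightarrow> ireg s x = ireg s y"
| "holds (RLess x y) s \<longleftrightarrow> rreg s x < rreg s y"
| "holds (REq x y) s \<longleftrightarrow> rreg s x = rreg s y"

text \<open>\<open>exec c s t s'\<close>: started in \<open>s\<close>, the program \<open>c\<close> terminates in \<open>s'\<close> after exactly \<open>t\<close>
  steps, where every executed instruction and every evaluated test is one step.\<close>

inductive exec :: "prog \<Rightarrow> state \<Rightarrow> nat \<Rightarrow> state \<Rightarrow> bool" where
  exec_Instr: "exec (Instr a) s 1 (step a s)"
| exec_Seq: "exec c1 s t1 s1 \<Longrightarrow> exec c2 s1 t2 s2 \<Longrightarrow> exec (Seq c1 c2) s (t1 + t2) s2"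
| exec_IfTrue: "holds b s \<Longrightarrow> exec c1 s t s' \<Longrightarrow> exec (If b c1 c2) s (1 + t) s'"
| exec_IfFalse: "\<not> holds b s \<Longrightarrow> exec c2 s t s' \<Longrightarrow> exec (If b c1 c2) s (1 + t) s'"
| exec_WhileFalse: "\<not> holds b s \<Longrightarrow> exec (While b c) s 1 s"
| exec_WhileTrue: "holds b s \<Longrightarrow> exec c s t1 s1 \<Longrightarrow> exec (While b c) s1 t2 s2 \<Longrightarrow>
    exec (While b c) s (1 + t1 + t2) s2"

inductive_cases exec_InstrE: "exec (Instr a) s t s'"
inductive_cases exec_SeqE: "exec (Seq c1 c2) s t s'"
inductive_cases exec_IfE: "exec (If b c1 c2) s t s'"
inductive_cases exec_WhileE: "exec (While b c) s t s'"

text \<open>Execution is deterministic, so the existence of a terminating execution with some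
  result means that the program always halts with that result.\<close>

lemma exec_deterministic:
  "exec c s t s' \<Longrightarrow> exec c s u s'' \<Longrightarrow> u = t \<and> s'' = s'"
proof (induction arbitrary: u s'' rule: exec.induct)
  case (exec_Instr a s)
  show ?case by (rule exec_InstrE[OF exec_Instr.prems]) simp
next
  case (exec_Seq c1 s t1 s1 c2 t2 s2)
  from exec_Seq.prems show ?case
  proof (rule exec_SeqE)
    fix v1 r1 v2
    assume *: "u = v1 + v2" "exec c1 s v1 r1" "exec c2 r1 v2 s''"
    have eq: "v1 = t1" "r1 = s1" using exec_Seq.IH(1)[OF *(2)] by simp_all
    show ?thesis using exec_Seq.IH(2)[OF *(3)[unfolded eq]] *(1) eq by simp
  qed
next
  case (exec_IfTrue b s c1 t s' c2)
  from exec_IfTrue.prems show ?case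
  proof (rule exec_IfE)
    fix v assume "u = Suc v" "exec c1 s v s''"
    then show ?thesis using exec_IfTrue.IH[of v s''] by simp
  qed (use exec_IfTrue.hyps in simp)
next
  case (exec_IfFalse b s c2 t s' c1)
  from exec_IfFalse.prems show ?case
  proof (rule exec_IfE)
    fix v assume "u = Suc v" "exec c2 s v s''"
    then show ?thesis using exec_IfFalse.IH[of v s''] by simp
  qed (use exec_IfFalse.hyps in simp)
next
  case (exec_WhileFalse b s c)
  from exec_WhileFalse.prems show ?case
    by (rule exec_WhileE) (use exec_WhileFalse.hyps in simp_all)
next
  case (exec_WhileTrue b s c t1 s1 t2 s2)
  from exec_WhileTrue.prems show ?case
  proof (rule exec_WhileE)
    fix v1 r1 v2
    assume *: "u = Suc (v1 + v2)" "exec c s v1 r1" "exec (While b c) r1 v2 s''"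
    have eq: "v1 = t1" "r1 = s1" using exec_WhileTrue.IH(1)[OF *(2)] by simp_all
    show ?thesis using exec_WhileTrue.IH(2)[OF *(3)[unfolded eq]] *(1) eq by simp
  qed (use exec_WhileTrue.hyps in simp)
qed

text \<open>
  Memory representation of a social network \<open>p\<close> and a product \<open>tp\<close>, where \<open>\<nu>\<close> numbers the
  nodes by \<open>0, \<dots>, n - 1\<close> and \<open>\<pi>\<close> numbers the products by \<open>0, \<dots>, m - 1\<close>:
  \<^item> integer registers 0, 1, 2 hold \<open>n\<close>, \<open>m\<close> and the number of \<open>tp\<close>;
  \<^item> integer array 0 is the \<open>n \<times> n\<close> adjacency matrix and real array 0 the \<open>n \<times> n\<close> weight
    matrix, both stored row by row, and real array 1 holds the \<open>n\<close> thresholds;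
  \<^item> the sets \<open>p(i)\<close> are represented by their characteristic vectors (the rows of the
    \<open>n \<times> m\<close> matrix in integer array 1) together with their sizes (integer array 2).

  Storing the sizes lets the machine test in constant time whether \<open>p(i)\<close> is a singleton; from
  the characteristic vectors alone this could not be done in time independent of \<open>m\<close>.
  All other registers and array cells are 0.
\<close>

definition encode ::
  "('v, 'p) setting \<Rightarrow> ('v \<Rightarrow> 'p set) \<Rightarrow> 'p \<Rightarrow> (nat \<Rightarrow> 'v) \<Rightarrow> (nat \<Rightarrow> 'p) \<Rightarrow> state" where
  "encode G p tp \<nu> \<pi> =
    (let n = card (nodes G); m = card (products G) in
     \<lparr> ireg = (\<lambda>_. 0)(0 := n, 1 := m, 2 := inv_into {..<m} \<pi> tp),
       rreg = (\<lambda>_. 0),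
       iarr = (\<lambda>_ _. 0)
         (0 := (\<lambda>x. if x < n * n \<and> (\<nu> (x div n), \<nu> (x mod n)) \<in> edges G then 1 else 0),
          1 := (\<lambda>x. if x < n * m \<and> \<pi> (x mod m) \<in> p (\<nu> (x div m)) then 1 else 0),
          2 := (\<lambda>x. if x < n then card (p (\<nu> x)) else 0)),
       rarr = (\<lambda>_ _. 0)
         (0 := (\<lambda>x. if x < n * n \<and> (\<nu> (x div n), \<nu> (x mod n)) \<in> edges G
                    then weight G (\<nu> (x div n)) (\<nu> (x mod n)) else 0),
          1 := (\<lambda>x. if x < n then threshold G (\<nu> x) else 0)) \<rparr>)"

text \<open>The program \<open>c\<close> decides, within \<open>T n\<close> steps on networks with \<open>n\<close> nodes, whether the
  network \<open>const_network G tp\<close> is reachable; the answer is delivered in integer register 0. Nodes and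
  products are natural numbers, so that one program serves all finite networks (up to
  renaming of nodes and products).\<close>

definition decides_reachability_within :: "prog \<Rightarrow> (nat \<Rightarrow> nat) \<Rightarrow> bool" where
  "decides_reachability_within c T \<longleftrightarrow>
    (\<forall>(G :: (nat, nat) setting) p tp \<nu> \<pi>.
       valid_setting G \<longrightarrow> p \<in> social_networks G \<longrightarrow> tp \<in> products G \<longrightarrow>
       bij_betw \<nu> {..<card (nodes G)} (nodes G) \<longrightarrow>
       bij_betw \<pi> {..<card (products G)} (products G) \<longrightarrow>
       (\<exists>t s. exec c (encode G p tp \<nu> \<pi>) t s \<and>
              t \<le> T (card (nodes G)) \<and>
              ireg s 0 = (if reachable G p (const_network G tp) then 1 else 0)))"

end

theory Submission
  imports Defs
begin

text \<open>
  Since a node holding a single product never changes again, \<open>[top]\<close> is reachable iff \<open>top\<close>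
  belongs to every \<open>p(i)\<close> and the greedy process that only ever adopts \<open>top\<close> exhausts the nodes:
  weights are non-negative, so adopting \<open>top\<close> never disables another adoption of \<open>top\<close>, and the
  order of adoptions does not matter. As in Dijkstra's algorithm, each of \<open>n\<close> rounds scans for a
  node that can adopt and has not yet been selected, and adds its row of the weight matrix to an
  array of accumulated influences. Nodes that hold only \<open>top\<close> from the start and nodes without
  neighbours are treated uniformly by resetting their thresholds to 0.
\<close>

section \<open>Greedy adoption\<close>

text \<open>In use \<open>w\<close> is 0 off the edges, so the sum over all of \<open>S\<close> is
  the influence of the selected neighbours alone.\<close>

definition ready :: "nat \<Rightarrow> (nat \<Rightarrow> nat \<Rightarrow> real) \<Rightarrow> (nat \<Rightarrow> real) \<Rightarrow> nat set \<Rightarrow> nat \<Rightarrow> bool" where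
  "ready n w h S j \<longleftrightarrow> j < n \<and> j \<notin> S \<and> h j \<le> (\<Sum>i\<in>S. w i j)"

text \<open>Any ready node may come next, so correctness does not depend on which candidate the scan
  picks.\<close>

inductive adoptable :: "nat \<Rightarrow> (nat \<Rightarrow> nat \<Rightarrow> real) \<Rightarrow> (nat \<Rightarrow> real) \<Rightarrow> nat set \<Rightarrow> bool"
  for n w h where
  adoptable_empty: "adoptable n w h {}"
| adoptable_insert: "adoptable n w h S \<Longrightarrow> ready n w h S j \<Longrightarrow> adoptable n w h (insert j S)"

lemma adoptable_subset: "adoptable n w h S \<Longrightarrow> S \<subseteq> {..<n}"
  by (induction rule: adoptable.induct) (auto simp: ready_def)

lemma adoptable_finite: "adoptable n w h S \<Longrightarrow> finite S"
  using finite_subset[OF adoptable_subset] by simp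

text \<open>The arrays in memory match the network only at indices below \<open>n\<close>; this and
  the next lemma carry the greedy process across.\<close>

lemma ready_cong:
  assumes "\<And>i j. i < n \<Longrightarrow> j < n \<Longrightarrow> w i j = w' i j" "\<And>j. j < n \<Longrightarrow> h j = h' j" "S \<subseteq> {..<n}"
  shows "ready n w h S j \<longleftrightarrow> ready n w' h' S j"
proof (cases "j < n")
  case True
  then have "(\<Sum>i\<in>S. w i j) = (\<Sum>i\<in>S. w' i j)"
    using assms by (intro sum.cong) auto
  with True assms(2) show ?thesis by (simp add: ready_def)
qed (simp add: ready_def)

lemma adoptable_cong:
  assumes "adoptable n w h S"
    and "\<And>i j. i < n \<Longrightarrow> j < n \<Longrightarrow> w i j = w' i j" "\<And>j. j < n \<Longrightarrow> h j = h' j"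
  shows "adoptable n w' h' S"
  using assms(1)
proof induction
  case (adoptable_insert S j)
  have "ready n w' h' S j"
    using ready_cong[of n w w' h h' S j, OF assms(2,3) adoptable_subset[OF adoptable_insert.hyps(1)]]
      adoptable_insert.hyps(2) by blast
  with adoptable_insert.IH show ?case by (rule adoptable.adoptable_insert)
qed (rule adoptable.adoptable_empty)

section \<open>Social networks as matrices over numbered nodes\<close>

locale numbered_network =
  fixes G :: "('v, 'p) setting" and p :: "'v \<Rightarrow> 'p set" and top :: 'p and \<nu> :: "nat \<Rightarrow> 'v"
  assumes valid: "valid_setting G"
    and network: "p \<in> social_networks G"
    and numbering: "bij_betw \<nu> {..<card (nodes G)} (nodes G)"
begin

abbreviation n where "n \<equiv> card (nodes G)"

definition influence :: "nat \<Rightarrow> nat \<Rightarrow> real" where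
  "influence i j = (if (\<nu> i, \<nu> j) \<in> edges G then weight G (\<nu> i) (\<nu> j) else 0)"

text \<open>Singletons other than \<open>{top}\<close> also get level 0. This is harmless:
  \<open>top\<close> is then missing from a set, which alone makes the answer negative.\<close>

definition level :: "nat \<Rightarrow> real" where
  "level j = (if neighbours G (\<nu> j) = {} \<or> card (p (\<nu> j)) = 1 then 0 else threshold G (\<nu> j))"

definition adopt_on :: "'v set \<Rightarrow> 'v \<Rightarrow> 'p set" where
  "adopt_on U = (\<lambda>v \<in> nodes G. if v \<in> U then {top} else p v)"

lemma node: "j < n \<Longrightarrow> \<nu> j \<in> nodes G"
  using numbering by (auto simp: bij_betw_def)

lemma node_image: "v \<in> nodes G \<Longrightarrow> \<exists>j<n. v = \<nu> j"
  using numbering by (auto simp: bij_betw_def)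

lemma inj_node: "inj_on \<nu> {..<n}"
  using numbering by (auto simp: bij_betw_def)

lemma neighbours_nodes: "neighbours G v \<subseteq> nodes G"
  using valid by (auto simp: valid_setting_def neighbours_def)

lemma finite_neighbours: "finite (neighbours G v)"
  using finite_subset[OF neighbours_nodes] valid by (auto simp: valid_setting_def)

lemma weight_nonneg: "u \<in> neighbours G v \<Longrightarrow> 0 \<le> weight G u v"
  using valid by (auto simp: valid_setting_def neighbours_def)

lemma influence_nonneg: "0 \<le> influence i j"
  using weight_nonneg by (auto simp: influence_def neighbours_def)

lemma threshold_nonneg: "v \<in> nodes G \<Longrightarrow> 0 \<le> threshold G v"
  using valid by (fastforce simp: valid_setting_def)

text \<open>Matches the matrix sum with the sum in \<open>adoption\<close>: \<open>\<nu>\<close> is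
  injective below \<open>n\<close>, and entries off the edges are 0.\<close>

lemma sum_influence:
  assumes "S \<subseteq> {..<n}"
  shows "(\<Sum>i\<in>S. influence i j) = (\<Sum>u \<in> {u \<in> neighbours G (\<nu> j). u \<in> \<nu> ` S}. weight G u (\<nu> j))"
proof -
  have inj: "inj_on \<nu> S" using inj_node assms by (rule inj_on_subset)
  have fin: "finite S" using assms finite_subset by blast
  have "(\<Sum>i\<in>S. influence i j)
      = (\<Sum>u\<in>\<nu> ` S. if u \<in> neighbours G (\<nu> j) then weight G u (\<nu> j) else 0)"
    by (simp add: sum.reindex[OF inj] influence_def neighbours_def)
  also have "\<dots> = (\<Sum>u \<in> {u \<in> \<nu> ` S. u \<in> neighbours G (\<nu> j)}. weight G u (\<nu> j))"
    using fin by (simp add: sum.inter_filter)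
  also have "{u \<in> \<nu> ` S. u \<in> neighbours G (\<nu> j)} = {u \<in> neighbours G (\<nu> j). u \<in> \<nu> ` S}"
    by blast
  finally show ?thesis .
qed

section \<open>Greedy runs are realised by reductions\<close>

lemma adopt_on_network:
  assumes "\<forall>v\<in>nodes G. top \<in> p v"
  shows "adopt_on U \<in> social_networks G"
  using assms network by (auto simp: adopt_on_def social_networks_def PiE_iff)

lemma adopt_on_insert_self:
  assumes "p v = {top}"
  shows "adopt_on (insert v U) = adopt_on U"
  using assms by (auto simp: adopt_on_def fun_eq_iff)

lemma adopt_on_empty: "adopt_on {} = p"
  using network by (auto simp: adopt_on_def social_networks_def intro: PiE_restrict)

text \<open>Two different products in \<open>p (\<nu> j)\<close> rule out a singleton, so the level
  is 0 only for lack of neighbours, where adoption is unconditional, and otherwise is the true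
  threshold.\<close>

lemma reduces_adopt_on:
  assumes top: "\<forall>v\<in>nodes G. top \<in> p v" and S: "S \<subseteq> {..<n}"
    and ready: "ready n influence level S j" and "p (\<nu> j) \<noteq> {top}"
  shows "reduces G (adopt_on (\<nu> ` S)) (adopt_on (\<nu> ` insert j S))"
proof -
  let ?v = "\<nu> j" and ?q = "adopt_on (\<nu> ` S)"
  have j: "j < n" "j \<notin> S" "level j \<le> (\<Sum>i\<in>S. influence i j)"
    using ready by (auto simp: ready_def)
  have v: "?v \<in> nodes G" using j node by blast
  have vS: "?v \<notin> \<nu> ` S"
    using inj_on_image_mem_iff[OF inj_node, of j S] j S by simp
  have "finite (p ?v)" and "top \<in> p ?v"
    using v valid network top
    by (auto simp: valid_setting_def social_networks_def PiE_iff intro: finite_subset)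
  moreover from this assms(4) obtain t where "t \<in> p ?v" "t \<noteq> top" by blast
  ultimately have card: "2 \<le> card (p ?v)"
    using card_mono[of "p ?v" "{t, top}"] by simp
  have adoption: "adoption G ?q top ?v"
  proof (cases "neighbours G ?v = {}")
    case False
    have "threshold G ?v = level j" using False card by (simp add: level_def)
    also have "\<dots> \<le> (\<Sum>u \<in> {u \<in> neighbours G ?v. u \<in> \<nu> ` S}. weight G u ?v)"
      using j(3) sum_influence[OF S] by simp
    \<comment> \<open>Nodes that hold \<open>{top}\<close> from the start count for adoption even
      before they are selected; by non-negativity they can only increase the sum.\<close>
    also have "\<dots> \<le> (\<Sum>u \<in> {u \<in> neighbours G ?v. ?q u = {top}}. weight G u ?v)"
    proof (rule sum_mono2)
      show "{u \<in> neighbours G ?v. u \<in> \<nu> ` S} \<subseteq> {u \<in> neighbours G ?v. ?q u = {top}}"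
        using neighbours_nodes by (auto simp: adopt_on_def)
    qed (use finite_neighbours weight_nonneg in auto)
    finally show ?thesis using False by (simp add: adoption_def)
  qed (simp add: adoption_def)
  have "?q ?v = p ?v" "adopt_on (\<nu> ` insert j S) ?v = {top}"
    using v vS by (simp_all add: adopt_on_def)
  moreover from this assms(4) have "adopt_on (\<nu> ` insert j S) \<noteq> ?q" by metis
  moreover have "u = ?v" if "u \<in> nodes G" "adopt_on (\<nu> ` insert j S) u \<noteq> ?q u" for u
    using that by (auto simp: adopt_on_def split: if_splits)
  ultimately show ?thesis
    unfolding reduces_def
    using adopt_on_network[OF top] card adoption \<open>top \<in> p ?v\<close> by metis
qed

text \<open>Selecting a node that starts with \<open>{top}\<close> leaves the network unchanged;
  every other selection is one reduction.\<close>

lemma reachable_adopt_on: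
  assumes "\<forall>v\<in>nodes G. top \<in> p v" "adoptable n influence level S"
  shows "reachable G p (adopt_on (\<nu> ` S))"
  using assms(2)
proof induction
  case adoptable_empty
  then show ?case by (simp add: adopt_on_empty reachable_def)
next
  case (adoptable_insert S j)
  show ?case
  proof (cases "p (\<nu> j) = {top}")
    case True
    then show ?thesis using adoptable_insert.IH by (simp add: adopt_on_insert_self)
  next
    case False
    then show ?thesis
      using reduces_adopt_on[OF assms(1) adoptable_subset[OF adoptable_insert.hyps(1)]
          adoptable_insert.hyps(2)] adoptable_insert.IH
      by (auto simp: reachable_def)
  qed
qed

section \<open>Reductions never leave a closed greedy set\<close>

lemma reachable_shrinks:
  assumes "reachable G p q" "v \<in> nodes G"
  shows "q v \<subseteq> p v"
  using assms(1) unfolding reachable_def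
proof induction
  case (step q q')
  then have "q' v = q v \<or> (\<exists>t\<in>q v. q' v = {t})"
    using assms(2) unfolding reduces_def by blast
  with step.IH show ?case by auto
qed simp

text \<open>By induction on the reductions: a new adopter of \<open>top\<close> is influenced only
  by holders of \<open>{top}\<close>, all numbered in \<open>S\<close>, so \<open>S\<close> meets
  its level; as nothing outside \<open>S\<close> is ready, it lies in \<open>S\<close>.\<close>

lemma closed_contains_adopters:
  assumes S: "S \<subseteq> {..<n}" and closed: "\<And>j. \<not> ready n influence level S j"
    and "reachable G p q"
  shows "\<forall>j<n. q (\<nu> j) = {top} \<longrightarrow> j \<in> S"
  using assms(3) unfolding reachable_def
proof induction
  case base
  show ?case
  proof (intro allI impI)
    fix j assume "j < n" "p (\<nu> j) = {top}"
    \<comment> \<open>A singleton has level 0, which the non-negative sum over \<open>S\<close>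
      always meets.\<close>
    then show "j \<in> S"
      using closed[of j] sum_nonneg[of S "\<lambda>i. influence i j"] influence_nonneg
      by (auto simp: ready_def level_def)
  qed
next
  case (step q q')
  show ?case
  proof (intro allI impI)
    fix j assume j: "j < n" and q': "q' (\<nu> j) = {top}"
    let ?v = "\<nu> j"
    show "j \<in> S"
    proof (cases "q ?v = {top}")
      case True
      with j step.IH show ?thesis by blast
    next
      case False
      then have "adoption G q top ?v"
        using step.hyps(2) q' node[OF j] unfolding reduces_def by force
      moreover have "(\<Sum>u \<in> {u \<in> neighbours G ?v. q u = {top}}. weight G u ?v)
          \<le> (\<Sum>u \<in> {u \<in> neighbours G ?v. u \<in> \<nu> ` S}. weight G u ?v)"
      proof (rule sum_mono2)
        show "{u \<in> neighbours G ?v. q u = {top}} \<subseteq> {u \<in> neighbours G ?v. u \<in> \<nu> ` S}"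
          using neighbours_nodes step.IH node_image by blast
      qed (use finite_neighbours weight_nonneg in auto)
      \<comment> \<open>If the level is 0, non-negativity suffices; otherwise it is the threshold,
        bounded by the adoption condition in \<open>q\<close>.\<close>
      ultimately have "level j \<le> (\<Sum>i\<in>S. influence i j)"
        using sum_influence[OF S, of j] sum_nonneg[of S "\<lambda>i. influence i j"] influence_nonneg
          threshold_nonneg[OF node[OF j]]
        by (auto simp: adoption_def level_def)
      then show ?thesis using closed[of j] j by (auto simp: ready_def)
    qed
  qed
qed

text \<open>The second assumption is what \<open>n\<close> rounds leave behind. If \<open>S\<close>
  were not all of \<open>{..<n}\<close>, it would be closed and so contain every holder of
  \<open>{top}\<close> in the target, that is, every node.\<close>

theorem reachable_const_iff:
  assumes "adoptable n influence level S"
    and "S = {..<n} \<or> (\<forall>j. \<not> ready n influence level S j)"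
  shows "reachable G p (const_network G top) \<longleftrightarrow> (\<forall>v\<in>nodes G. top \<in> p v) \<and> S = {..<n}"
proof (intro iffI conjI)
  assume reach: "reachable G p (const_network G top)"
  then show "\<forall>v\<in>nodes G. top \<in> p v"
    using reachable_shrinks by (fastforce simp: const_network_def)
  have const: "\<forall>j<n. const_network G top (\<nu> j) = {top}"
    using node by (simp add: const_network_def)
  show "S = {..<n}"
    using assms(2) closed_contains_adopters[OF adoptable_subset[OF assms(1)] _ reach] const
      adoptable_subset[OF assms(1)] by blast
next
  assume *: "(\<forall>v\<in>nodes G. top \<in> p v) \<and> S = {..<n}"
  have "adopt_on (\<nu> ` S) = const_network G top"
    using * numbering by (auto simp: adopt_on_def const_network_def bij_betw_def fun_eq_iff)
  then show "reachable G p (const_network G top)"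
    using reachable_adopt_on[OF _ assms(1)] * by simp
qed

end

section \<open>Timed total correctness\<close>

definition triple :: "(state \<Rightarrow> bool) \<Rightarrow> prog \<Rightarrow> nat \<Rightarrow> (state \<Rightarrow> bool) \<Rightarrow> bool" where
  "triple P c T Q \<longleftrightarrow> (\<forall>s. P s \<longrightarrow> (\<exists>t s'. exec c s t s' \<and> t \<le> T \<and> Q s'))"

text \<open>For code without loops, \<open>run\<close> computes the final state by simplification
  and \<open>cost\<close> bounds the steps. Their equations for \<open>While\<close> are mere
  defaults, excluded here.\<close>

fun loop_free :: "prog \<Rightarrow> bool" where
  "loop_free (Instr a) \<longleftrightarrow> True"
| "loop_free (Seq c d) \<longleftrightarrow> loop_free c \<and> loop_free d"
| "loop_free (If b c d) \<longleftrightarrow> loop_free c \<and> loop_free d"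
| "loop_free (While b c) \<longleftrightarrow> False"

fun run :: "prog \<Rightarrow> state \<Rightarrow> state" where
  "run (Instr a) s = step a s"
| "run (Seq c d) s = run d (run c s)"
| "run (If b c d) s = (if holds b s then run c s else run d s)"
| "run (While b c) s = s"

fun cost :: "prog \<Rightarrow> nat" where
  "cost (Instr a) = 1"
| "cost (Seq c d) = cost c + cost d"
| "cost (If b c d) = 1 + max (cost c) (cost d)"
| "cost (While b c) = 0"

lemma exec_run: "loop_free c \<Longrightarrow> \<exists>t. exec c s t (run c s) \<and> t \<le> cost c"
proof (induction c arbitrary: s)
  case (Instr a)
  show ?case using exec_Instr by auto
next
  case (Seq c d)
  then obtain t u where "exec c s t (run c s)" "t \<le> cost c"
    "exec d (run c s) u (run d (run c s))" "u \<le> cost d"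
    by (metis loop_free.simps(2))
  then show ?case using exec_Seq by (metis add_mono cost.simps(2) run.simps(2))
next
  case (If b c d)
  then obtain t u where "exec c s t (run c s)" "t \<le> cost c"
    "exec d s u (run d s)" "u \<le> cost d"
    by (metis loop_free.simps(3))
  then show ?case
    using exec_IfTrue[of b s c t "run c s" d] exec_IfFalse[of b s d u "run d s" c]
    by (cases "holds b s") (fastforce intro: le_max_iff_disj[THEN iffD2])+
qed simp

lemma triple_loop_free:
  assumes "loop_free c" "cost c \<le> T" "\<And>s. P s \<Longrightarrow> Q (run c s)"
  shows "triple P c T Q"
  unfolding triple_def using exec_run[OF assms(1)] assms(2,3) order_trans by blast

section \<open>Proof rules for timed triples\<close>

lemma triple_Seq:
  assumes "triple P c T Q" "triple Q d U R"
  shows "triple P (Seq c d) (T + U) R"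
  using assms unfolding triple_def by (meson add_mono exec_Seq)

lemma triple_If:
  assumes "triple (\<lambda>s. P s \<and> holds b s) c T Q" "triple (\<lambda>s. P s \<and> \<not> holds b s) d T Q"
  shows "triple P (If b c d) (1 + T) Q"
  unfolding triple_def
proof (intro allI impI)
  fix s assume P: "P s"
  show "\<exists>t s'. exec (If b c d) s t s' \<and> t \<le> 1 + T \<and> Q s'"
  proof (cases "holds b s")
    case True
    then obtain t s' where "exec c s t s'" "t \<le> T" "Q s'"
      using assms(1) P unfolding triple_def by blast
    then show ?thesis using exec_IfTrue[OF True] by (metis add_left_mono)
  next
    case False
    then obtain t s' where "exec d s t s'" "t \<le> T" "Q s'"
      using assms(2) P unfolding triple_def by blast
    then show ?thesis using exec_IfFalse[OF False] by (metis add_left_mono)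
  qed
qed

lemma triple_conseq:
  assumes "triple P c T Q" "\<And>s. P' s \<Longrightarrow> P s" "T \<le> T'" "\<And>s. Q s \<Longrightarrow> Q' s"
  shows "triple P' c T' Q'"
  using assms unfolding triple_def by (meson order_trans)

text \<open>Fixes a logical variable, such as the set of selected nodes, before the program is
  analysed.\<close>

lemma triple_ex:
  assumes "\<And>x. triple (P x) c T Q"
  shows "triple (\<lambda>s. \<exists>x. P x s) c T Q"
  using assms unfolding triple_def by blast

text \<open>For counting loops; \<open>k\<close> is the number of completed iterations. Each of the
  \<open>K\<close> iterations costs \<open>T\<close> plus one test, and the failing last test adds
  1.\<close>

lemma triple_While:
  assumes body: "\<And>k. k < K \<Longrightarrow> triple (I k) c T (I (Suc k))"
    and test: "\<And>k s. I k s \<Longrightarrow> holds b s \<longleftrightarrow> k < K"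
  shows "triple (I 0) (While b c) (K * (T + 1) + 1) (I K)"
proof -
  have "k \<le> K \<Longrightarrow> triple (I k) (While b c) ((K - k) * (T + 1) + 1) (I K)" for k
  proof (induction "K - k" arbitrary: k)
    case 0
    then have "k = K" by simp
    then show ?case
      using test exec_WhileFalse unfolding triple_def by fastforce
  next
    case (Suc d)
    then have k: "k < K" "d = K - Suc k" by simp_all
    have rest: "triple (I (Suc k)) (While b c) (d * (T + 1) + 1) (I K)"
      using Suc.hyps(1)[of "Suc k"] k by simp
    show ?case
      unfolding triple_def
    proof (intro allI impI)
      fix s assume I: "I k s"
      then obtain t1 s1 where 1: "exec c s t1 s1" "t1 \<le> T" "I (Suc k) s1"
        using body[OF k(1)] unfolding triple_def by blast
      then obtain t2 s2 where 2: "exec (While b c) s1 t2 s2" "t2 \<le> d * (T + 1) + 1" "I K s2"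
        using rest unfolding triple_def by blast
      have "exec (While b c) s (1 + t1 + t2) s2"
        using test[OF I] k(1) 1(1) 2(1) exec_WhileTrue by blast
      moreover have "1 + t1 + t2 \<le> (K - k) * (T + 1) + 1"
        using 1(2) 2(2) Suc.hyps(2)[symmetric] by simp
      ultimately show "\<exists>t s'. exec (While b c) s t s' \<and> t \<le> (K - k) * (T + 1) + 1 \<and> I K s'"
        using 2(3) by blast
    qed
  qed
  from this[of 0] show ?thesis by simp
qed

section \<open>The program\<close>

fun block :: "prog list \<Rightarrow> prog" where
  "block [] = Instr Skip"
| "block [c] = c"
| "block (c # cs) = Seq c (block cs)"

text \<open>Register usage: 3 and 10 hold the constants 1 and 0; 4 and 5 are the outer and inner loop
  counters; 6, 8 and 13 run through matrix indices, so that no multiplication is needed; 7 is the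
  in-degree; 11 becomes 1 once some node does not offer the product; 12 is the candidate found by
  the scan (\<open>n\<close> if there is none); 14 counts the selected nodes. Integer array 3 marks the selected
  nodes, and real array 2 accumulates their influence on each node.\<close>

definition indegree_loop :: prog where
  "indegree_loop = While (ILess 5 0) (block
     [Instr (ILoad 9 0 6), Instr (IAdd 7 7 9), Instr (IAdd 6 6 0), Instr (IAdd 5 5 3)])"

text \<open>Adding register 10 copies a register. Register 6 starts at the top of the node's column.
  Real register 0 is never written and supplies the 0 for reset thresholds.\<close>

definition init_body :: prog where
  "init_body = Seq
     (block [Instr (ILoad 9 1 8), If (IEq 9 3) (Instr Skip) (Instr (IConst 11 1)),
       Instr (IAdd 8 8 1), Instr (IConst 5 0), Instr (IConst 7 0), Instr (IAdd 6 4 10)])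
     (Seq indegree_loop
     (block [Instr (ILoad 9 2 4),
       If (IEq 7 10) (Instr (RStore 1 4 0)) (If (IEq 9 3) (Instr (RStore 1 4 0)) (Instr Skip)),
       Instr (IAdd 4 4 3)]))"

definition init_loop :: prog where
  "init_loop = While (ILess 4 0) init_body"

text \<open>There is no early exit: a later ready node overwrites an earlier one, together with its
  row offset in register 13.\<close>

definition scan_loop :: prog where
  "scan_loop = While (ILess 5 0) (block
     [Instr (ILoad 9 3 5),
      If (IEq 9 10)
        (block [Instr (RLoad 1 2 5), Instr (RLoad 2 1 5),
          If (RLess 1 2) (Instr Skip) (Seq (Instr (IAdd 12 5 10)) (Instr (IAdd 13 6 10)))])
        (Instr Skip),
      Instr (IAdd 6 6 0), Instr (IAdd 5 5 3)])"

definition update_loop :: prog where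
  "update_loop = While (ILess 5 0) (block
     [Instr (RLoad 1 2 5), Instr (RLoad 2 0 13), Instr (RAdd 1 1 2), Instr (RStore 2 5 1),
      Instr (IAdd 13 13 3), Instr (IAdd 5 5 3)])"

definition adoption_loop :: prog where
  "adoption_loop = While (ILess 4 0) (Seq
     (block [Instr (IConst 5 0), Instr (IConst 6 0), Instr (IAdd 12 0 10)])
     (Seq scan_loop
     (Seq (If (ILess 12 0)
        (Seq (block [Instr (IStore 3 12 3), Instr (IAdd 14 14 3), Instr (IConst 5 0)]) update_loop)
        (Instr Skip))
     (Instr (IAdd 4 4 3)))))"

definition decider :: prog where
  "decider = Seq (Seq (Instr (IConst 3 1)) (Instr (IAdd 8 2 10)))
     (Seq init_loop (Seq (Instr (IConst 4 0)) (Seq adoption_loop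
       (If (IEq 11 10) (If (IEq 14 0) (Instr (IConst 0 1)) (Instr (IConst 0 0)))
         (Instr (IConst 0 0))))))"

subsection \<open>Initialisation\<close>

context
  fixes n m tp :: nat and A M C :: "nat \<Rightarrow> nat" and W \<Theta> :: "nat \<Rightarrow> real"
begin

definition indegree :: "nat \<Rightarrow> nat" where
  "indegree j = (\<Sum>i<n. A (i * n + j))"

text \<open>The thresholds once the first \<open>k\<close> nodes are treated; for an encoded network
  and \<open>k = n\<close> they agree with \<open>level\<close> below \<open>n\<close>.\<close>

definition init_threshold :: "nat \<Rightarrow> nat \<Rightarrow> real" where
  "init_threshold k = (\<lambda>x. if x < k \<and> (indegree x = 0 \<or> C x = 1) then 0 else \<Theta> x)"

definition init_frame :: "nat \<Rightarrow> state \<Rightarrow> bool" where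
  "init_frame k s \<longleftrightarrow> ireg s 0 = n \<and> ireg s 1 = m \<and> ireg s 3 = 1 \<and> ireg s 10 = 0 \<and> ireg s 14 = 0
     \<and> ireg s 4 = k \<and> rreg s 0 = 0 \<and> iarr s 0 = A \<and> iarr s 1 = M \<and> iarr s 2 = C
     \<and> iarr s 3 = (\<lambda>_. 0) \<and> rarr s 0 = W \<and> rarr s 2 = (\<lambda>_. 0) \<and> rarr s 1 = init_threshold k"

text \<open>Two counters, because the product test of a node precedes its threshold reset: in the
  middle of the loop body \<open>l\<close> is \<open>Suc k\<close>.\<close>

definition init_inv :: "nat \<Rightarrow> nat \<Rightarrow> state \<Rightarrow> bool" where
  "init_inv k l s \<longleftrightarrow> init_frame k s \<and> ireg s 8 = l * m + tp
     \<and> (ireg s 11 = 0 \<longleftrightarrow> (\<forall>j<l. M (j * m + tp) = 1))"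

lemma triple_indegree_loop:
  "triple (\<lambda>s. init_inv k l s \<and> ireg s 5 = 0 \<and> ireg s 7 = 0 \<and> ireg s 6 = k)
     indegree_loop (n * 5 + 1) (\<lambda>s. init_inv k l s \<and> ireg s 7 = indegree k)"
proof -
  define I where "I i s \<longleftrightarrow> init_inv k l s \<and> ireg s 5 = i \<and> ireg s 6 = i * n + k
    \<and> ireg s 7 = (\<Sum>x<i. A (x * n + k))" for i s
  have "triple (I 0) indegree_loop (n * (4 + 1) + 1) (I n)"
    unfolding indegree_loop_def
  proof (rule triple_While)
    fix i assume "i < n"
    show "triple (I i) (block [Instr (ILoad 9 0 6), Instr (IAdd 7 7 9), Instr (IAdd 6 6 0),
      Instr (IAdd 5 5 3)]) 4 (I (Suc i))"
      by (rule triple_loop_free) (simp_all add: I_def init_inv_def init_frame_def)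
  qed (simp add: I_def init_inv_def init_frame_def)
  then show ?thesis
    by (rule triple_conseq) (simp_all add: I_def indegree_def)
qed

lemma triple_init_body:
  "triple (init_inv k k) init_body (7 + ((n * 5 + 1) + 5)) (init_inv (Suc k) (Suc k))"
  unfolding init_body_def
  by (rule triple_Seq[OF triple_loop_free
        triple_Seq[OF triple_indegree_loop[of k "Suc k"] triple_loop_free]])
    (auto simp: init_inv_def init_frame_def init_threshold_def fun_eq_iff less_Suc_eq)

lemma triple_init_loop:
  "triple (init_inv 0 0) init_loop (n * (5 * n + 14) + 1) (init_inv n n)"
proof -
  have "triple (init_inv 0 0) init_loop (n * ((7 + ((n * 5 + 1) + 5)) + 1) + 1) (init_inv n n)"
    unfolding init_loop_def
    by (rule triple_While[of n "\<lambda>k. init_inv k k", OF triple_init_body])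
      (simp add: init_inv_def init_frame_def)
  then show ?thesis by (rule triple_conseq) (simp_all add: algebra_simps)
qed

end

subsection \<open>Adoption rounds\<close>

context
  fixes n flag :: nat and W H :: "nat \<Rightarrow> real"
begin

abbreviation "row_weight \<equiv> (\<lambda>i j. W (i * n + j))"

definition round_frame :: "nat \<Rightarrow> state \<Rightarrow> bool" where
  "round_frame k s \<longleftrightarrow> ireg s 0 = n \<and> ireg s 3 = 1 \<and> ireg s 10 = 0 \<and> ireg s 11 = flag
     \<and> ireg s 4 = k \<and> rarr s 0 = W \<and> rarr s 1 = H"

definition selected :: "nat set \<Rightarrow> state \<Rightarrow> bool" where
  "selected S s \<longleftrightarrow> ireg s 14 = card S \<and> iarr s 3 = (\<lambda>x. if x \<in> S then 1 else 0)"

definition accumulated :: "nat set \<Rightarrow> state \<Rightarrow> bool" where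
  "accumulated S s \<longleftrightarrow> (\<forall>j<n. rarr s 2 j = (\<Sum>i\<in>S. row_weight i j))"

text \<open>A round either enlarges \<open>S\<close> by one node or finds nothing ready, after which
  \<open>S\<close> stays fixed. Hence the last disjunction.\<close>

definition round_inv :: "nat \<Rightarrow> nat set \<Rightarrow> state \<Rightarrow> bool" where
  "round_inv k S s \<longleftrightarrow> round_frame k s \<and> selected S s \<and> accumulated S s
     \<and> adoptable n row_weight H S \<and> (card S = k \<or> (\<forall>j. \<not> ready n row_weight H S j))"

definition candidate :: "nat set \<Rightarrow> nat \<Rightarrow> state \<Rightarrow> bool" where
  "candidate S l s \<longleftrightarrow>
     (if ireg s 12 < n then ready n row_weight H S (ireg s 12) \<and> ireg s 13 = ireg s 12 * n
      else \<forall>j<l. \<not> ready n row_weight H S j)"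

lemma triple_scan_loop:
  "triple (\<lambda>s. round_inv k S s \<and> ireg s 5 = 0 \<and> ireg s 6 = 0 \<and> ireg s 12 = n)
     scan_loop (n * 11 + 1) (\<lambda>s. round_inv k S s \<and> candidate S n s)"
proof -
  define I where "I l s \<longleftrightarrow> round_inv k S s \<and> ireg s 5 = l \<and> ireg s 6 = l * n
    \<and> candidate S l s" for l s
  have "triple (I 0) scan_loop (n * (10 + 1) + 1) (I n)"
    unfolding scan_loop_def
  proof (rule triple_While, rule triple_loop_free)
    fix l s assume l: "l < n" and I: "I l s"
    show "I (Suc l) (run (block
     [Instr (ILoad 9 3 5),
      If (IEq 9 10)
        (block [Instr (RLoad 1 2 5), Instr (RLoad 2 1 5),
          If (RLess 1 2) (Instr Skip) (Seq (Instr (IAdd 12 5 10)) (Instr (IAdd 13 6 10)))])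
        (Instr Skip),
      Instr (IAdd 6 6 0), Instr (IAdd 5 5 3)]) s)"
    proof -
      \<comment> \<open>By \<open>accumulated\<close>, the mark in array 3 and the real comparison
        together decide readiness.\<close>
      have "ready n row_weight H S l \<longleftrightarrow> l \<notin> S \<and> \<not> rarr s 2 l < H l"
        using I l by (auto simp: I_def round_inv_def accumulated_def ready_def)
      then show ?thesis
        using I l
        by (auto simp: I_def round_inv_def round_frame_def selected_def accumulated_def
            candidate_def less_Suc_eq)
    qed
  qed (simp_all add: I_def round_inv_def round_frame_def)
  then show ?thesis
    by (rule triple_conseq) (simp_all add: I_def candidate_def)
qed

lemma triple_update_loop:
  assumes "finite S" "f \<notin> S"
  shows "triple (\<lambda>s. round_frame k s \<and> selected (insert f S) s \<and> accumulated S s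
      \<and> ireg s 5 = 0 \<and> ireg s 13 = f * n)
     update_loop (n * 7 + 1)
     (\<lambda>s. round_frame k s \<and> selected (insert f S) s \<and> accumulated (insert f S) s)"
proof -
  \<comment> \<open>Entries below \<open>l\<close> already include the row of \<open>f\<close>,
    along which register 13 walks.\<close>
  define I where "I l s \<longleftrightarrow> round_frame k s \<and> selected (insert f S) s
    \<and> ireg s 5 = l \<and> ireg s 13 = f * n + l
    \<and> (\<forall>j<n. rarr s 2 j = (\<Sum>i\<in>(if j < l then insert f S else S). row_weight i j))" for l s
  have "triple (I 0) update_loop (n * (6 + 1) + 1) (I n)"
    unfolding update_loop_def
  proof (rule triple_While, rule triple_loop_free)
    fix l s assume "l < n" "I l s"
    then show "I (Suc l) (run (block
     [Instr (RLoad 1 2 5), Instr (RLoad 2 0 13), Instr (RAdd 1 1 2), Instr (RStore 2 5 1),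
      Instr (IAdd 13 13 3), Instr (IAdd 5 5 3)]) s)"
      using assms by (auto simp: I_def round_frame_def selected_def less_Suc_eq)
  qed (simp_all add: I_def round_frame_def)
  then show ?thesis
    by (rule triple_conseq) (simp_all add: I_def accumulated_def)
qed

lemma triple_update:
  "triple (\<lambda>s. round_inv k S s \<and> candidate S n s)
     (Seq (If (ILess 12 0)
        (Seq (block [Instr (IStore 3 12 3), Instr (IAdd 14 14 3), Instr (IConst 5 0)]) update_loop)
        (Instr Skip))
     (Instr (IAdd 4 4 3)))
     ((1 + (3 + (n * 7 + 1))) + 1) (\<lambda>s. \<exists>S. round_inv (Suc k) S s)"
\<comment> \<open>The intermediate assertion is that of \<open>round_inv (Suc k)\<close> with the
  frame still at \<open>k\<close>, since register 4 is incremented last.\<close>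
proof (rule triple_Seq[OF triple_If triple_loop_free[where P =
        "\<lambda>s. \<exists>S. round_frame k s \<and> selected S s \<and> accumulated S s \<and> adoptable n row_weight H S
          \<and> (card S = Suc k \<or> (\<forall>j. \<not> ready n row_weight H S j))"]], goal_cases)
  case 1
  let ?P = "\<lambda>f s. ready n row_weight H S f \<and> ireg s 12 = f \<and> ireg s 13 = f * n \<and> round_inv k S s"
  have "triple (\<lambda>s. \<exists>f. ?P f s)
     (Seq (block [Instr (IStore 3 12 3), Instr (IAdd 14 14 3), Instr (IConst 5 0)]) update_loop)
     (3 + (n * 7 + 1))
     (\<lambda>s. \<exists>S. round_frame k s \<and> selected S s \<and> accumulated S s \<and> adoptable n row_weight H S
          \<and> (card S = Suc k \<or> (\<forall>j. \<not> ready n row_weight H S j)))"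
  proof (rule triple_ex)
    fix f
    show "triple (?P f)
     (Seq (block [Instr (IStore 3 12 3), Instr (IAdd 14 14 3), Instr (IConst 5 0)]) update_loop)
     (3 + (n * 7 + 1))
     (\<lambda>s. \<exists>S. round_frame k s \<and> selected S s \<and> accumulated S s \<and> adoptable n row_weight H S
          \<and> (card S = Suc k \<or> (\<forall>j. \<not> ready n row_weight H S j)))"
    \<comment> \<open>These facts do not mention the state and follow from the precondition; where
      they fail, no state satisfies it and the triple is vacuous.\<close>
    proof (cases "adoptable n row_weight H S \<and> ready n row_weight H S f
        \<and> (card S = k \<or> (\<forall>j. \<not> ready n row_weight H S j))")
      case True
      then have S: "finite S" "f \<notin> S" "card S = k" "adoptable n row_weight H (insert f S)"
        by (auto simp: adoptable_finite ready_def intro: adoptable_insert)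
      have "triple (?P f) (block [Instr (IStore 3 12 3), Instr (IAdd 14 14 3), Instr (IConst 5 0)])
        3 (\<lambda>s. round_frame k s \<and> selected (insert f S) s \<and> accumulated S s
            \<and> ireg s 5 = 0 \<and> ireg s 13 = f * n)"
        by (rule triple_loop_free)
          (use S in \<open>auto simp: round_inv_def round_frame_def selected_def accumulated_def\<close>)
      from triple_Seq[OF this triple_update_loop[OF S(1,2)]] show ?thesis
        by (rule triple_conseq) (use S in \<open>auto intro!: exI[of _ "insert f S"]\<close>)
    next
      case False
      then show ?thesis by (auto simp: triple_def round_inv_def)
    qed
  qed
  then show ?case
    by (rule triple_conseq)
      (auto simp: candidate_def round_inv_def round_frame_def split: if_splits)
next
  case 2
  \<comment> \<open>No number below \<open>n\<close> is ready by the scan, and none from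
    \<open>n\<close> on by definition, so \<open>S\<close> is closed.\<close>
  show ?case
    by (rule triple_loop_free)
      (auto simp: candidate_def round_inv_def round_frame_def selected_def accumulated_def
        ready_def intro!: exI[of _ S])
next
  case (5 s)
  then show ?case
    by (auto simp: round_inv_def round_frame_def selected_def accumulated_def)
qed simp_all

lemma triple_adoption_loop:
  "triple (\<lambda>s. \<exists>S. round_inv 0 S s) adoption_loop (n * (18 * n + 11) + 1) (\<lambda>s. \<exists>S. round_inv n S s)"
proof -
  have "triple (\<lambda>s. \<exists>S. round_inv 0 S s) adoption_loop
    (n * ((3 + ((n * 11 + 1) + ((1 + (3 + (n * 7 + 1))) + 1))) + 1) + 1) (\<lambda>s. \<exists>S. round_inv n S s)"
    unfolding adoption_loop_def
  proof (rule triple_While[of n "\<lambda>k s. \<exists>S. round_inv k S s"], rule triple_ex, goal_cases)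
    case (1 k S)
    show ?case
      by (rule triple_Seq[OF triple_loop_free triple_Seq[OF triple_scan_loop triple_update]])
        (auto simp: round_inv_def round_frame_def selected_def accumulated_def)
  qed (auto simp: round_inv_def round_frame_def)
  then show ?thesis by (rule triple_conseq) (simp_all add: algebra_simps)
qed

end

subsection \<open>Correctness of the program\<close>

text \<open>The summands follow the order of the program; the final 3 covers two tests and the
  output instruction.\<close>

definition time_bound :: "nat \<Rightarrow> nat" where
  "time_bound n = 2 + ((n * (5 * n + 14) + 1) + (1 + ((n * (18 * n + 11) + 1) + 3)))"

lemma time_bound_bigo: "(\<lambda>n. real (time_bound n)) \<in> O(\<lambda>n. real n ^ 2)"
proof (rule landau_o.bigI)
  \<comment> \<open>The bound expands to \<open>23 * n^2 + 25 * n + 8\<close>, which for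
    \<open>n \<ge> 1\<close> is at most \<open>(23 + 25 + 8) * n^2\<close>.\<close>
  show "\<forall>\<^sub>F n in sequentially. norm (real (time_bound n)) \<le> 56 * norm (real n ^ 2)"
    using eventually_ge_at_top[of 1]
  proof eventually_elim
    case (elim n)
    have "n \<le> n * n" "1 \<le> n * n" using elim by simp_all
    then have "time_bound n \<le> 56 * (n * n)"
      unfolding time_bound_def add_mult_distrib2 by linarith
    then have "real (time_bound n) \<le> real (56 * (n * n))" by (rule of_nat_mono)
    then show ?case by (simp add: power2_eq_square)
  qed
qed simp

text \<open>An encoded state has 0 in register 3, so the frame is required of the state in which the
  constant 1 has been stored there.\<close>

lemma triple_decider:
  "triple (\<lambda>s. init_frame n m A M C W \<Theta> 0 (s\<lparr>ireg := (ireg s)(3 := 1)\<rparr>)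
      \<and> ireg s 2 = tp \<and> ireg s 11 = 0)
     decider (time_bound n)
     (\<lambda>s. \<exists>S. adoptable n (\<lambda>i j. W (i * n + j)) (init_threshold n A C \<Theta> n) S
        \<and> (S = {..<n} \<or> (\<forall>j. \<not> ready n (\<lambda>i j. W (i * n + j)) (init_threshold n A C \<Theta> n) S j))
        \<and> ireg s 0 = (if (\<forall>j<n. M (j * m + tp) = 1) \<and> S = {..<n} then 1 else 0))"
  (is "triple _ _ _ ?Q")
  unfolding decider_def time_bound_def
proof (intro triple_Seq)
  let ?H = "init_threshold n A C \<Theta> n"
  \<comment> \<open>Initialisation determines only whether the flag is 0. Its value \<open>b\<close>
    stays constant during the rounds and is quantified outside them.\<close>
  let ?F = "\<lambda>b. b = 0 \<longleftrightarrow> (\<forall>j<n. M (j * m + tp) = 1)"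
  show "triple (\<lambda>s. init_frame n m A M C W \<Theta> 0 (s\<lparr>ireg := (ireg s)(3 := 1)\<rparr>)
      \<and> ireg s 2 = tp \<and> ireg s 11 = 0) (Seq (Instr (IConst 3 1)) (Instr (IAdd 8 2 10))) 2
      (init_inv n m tp A M C W \<Theta> 0 0)"
    by (rule triple_loop_free) (auto simp: init_inv_def init_frame_def)
  show "triple (init_inv n m tp A M C W \<Theta> 0 0) init_loop (n * (5 * n + 14) + 1)
      (init_inv n m tp A M C W \<Theta> n n)"
    by (rule triple_init_loop)
  show "triple (init_inv n m tp A M C W \<Theta> n n) (Instr (IConst 4 0)) 1
      (\<lambda>s. \<exists>b. ?F b \<and> (\<exists>S. round_inv n b W ?H 0 S s))"
    by (rule triple_loop_free)
      (auto simp: init_inv_def init_frame_def round_inv_def round_frame_def selected_def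
        accumulated_def intro!: exI[of _ "{}"] adoptable_empty)
  show "triple (\<lambda>s. \<exists>b. ?F b \<and> (\<exists>S. round_inv n b W ?H 0 S s)) adoption_loop
      (n * (18 * n + 11) + 1) (\<lambda>s. \<exists>b. ?F b \<and> (\<exists>S. round_inv n b W ?H n S s))"
  proof (rule triple_ex)
    fix b
    show "triple (\<lambda>s. ?F b \<and> (\<exists>S. round_inv n b W ?H 0 S s)) adoption_loop
      (n * (18 * n + 11) + 1) (\<lambda>s. \<exists>b. ?F b \<and> (\<exists>S. round_inv n b W ?H n S s))"
    proof (cases "?F b")
      case True
      show ?thesis
      proof (rule triple_conseq[OF triple_adoption_loop[of n b W ?H] _ order_refl])
        show "\<exists>b. ?F b \<and> (\<exists>S. round_inv n b W ?H n S s)"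
          if "\<exists>S. round_inv n b W ?H n S s" for s
          by (rule exI[of _ b], rule conjI[OF True that])
      qed (erule conjunct2)
    next
      case False
      then show ?thesis unfolding triple_def by blast
    qed
  qed
  show "triple (\<lambda>s. \<exists>b. ?F b \<and> (\<exists>S. round_inv n b W ?H n S s))
     (If (IEq 11 10) (If (IEq 14 0) (Instr (IConst 0 1)) (Instr (IConst 0 0)))
         (Instr (IConst 0 0))) 3 ?Q"
  proof (rule triple_loop_free, goal_cases)
    case (3 s)
    then obtain b S where F: "?F b" and inv: "round_inv n b W ?H n S s"
      by (elim exE conjE)
    have S: "adoptable n (\<lambda>i j. W (i * n + j)) ?H S"
      using inv by (simp only: round_inv_def)
    have "S \<subseteq> {..<n}" by (rule adoptable_subset[OF S])
    then have "card S = n \<longleftrightarrow> S = {..<n}"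
      using card_subset_eq[of "{..<n}" S] by auto
    with F inv show ?case
      by (auto simp: round_inv_def round_frame_def selected_def intro!: exI[of _ S])
  qed simp_all
qed

lemma index_less: "i < n \<Longrightarrow> j < m \<Longrightarrow> i * m + j < n * (m :: nat)"
  using mult_le_mono1[of "Suc i" n m] by simp

lemma decides_decider: "decides_reachability_within decider time_bound"
  unfolding decides_reachability_within_def
proof (intro allI impI)
  fix G :: "(nat, nat) setting" and p tp \<nu> \<pi>
  assume valid: "valid_setting G" and p: "p \<in> social_networks G" and tp: "tp \<in> products G"
    and \<nu>: "bij_betw \<nu> {..<card (nodes G)} (nodes G)"
    and \<pi>: "bij_betw \<pi> {..<card (products G)} (products G)"
  interpret numbered_network G p tp \<nu> by unfold_locales fact+
  define m where "m = card (products G)"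
  define e where "e = encode G p tp \<nu> \<pi>"
  define k where "k = inv_into {..<m} \<pi> tp"
  have k: "k < m" "\<pi> k = tp"
    using \<pi> tp inv_into_into[of tp \<pi> "{..<m}"] f_inv_into_f[of tp \<pi> "{..<m}"]
    by (auto simp: k_def m_def bij_betw_def)
  let ?W = "rarr e 0" and ?H = "init_threshold n (iarr e 0) (iarr e 2) (rarr e 1) n"
  let ?w = "\<lambda>i j. ?W (i * n + j)"
  have edge: "iarr e 0 (i * n + j) = (if (\<nu> i, \<nu> j) \<in> edges G then 1 else 0)"
    and W: "?w i j = influence i j" if "i < n" "j < n" for i j
    using that index_less[of i n j n] by (auto simp: e_def encode_def Let_def influence_def)
  have M: "iarr e 1 (j * m + k) = 1 \<longleftrightarrow> tp \<in> p (\<nu> j)" if "j < n" for j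
    using that k index_less[of j n k m] by (auto simp: e_def encode_def Let_def m_def[symmetric])
  \<comment> \<open>A sum of 0-1 entries vanishes iff all of them do, and the numbering reaches
    every node.\<close>
  have "indegree n (iarr e 0) j = 0 \<longleftrightarrow> neighbours G (\<nu> j) = {}" if "j < n" for j
  proof -
    have "indegree n (iarr e 0) j = 0 \<longleftrightarrow> (\<forall>i<n. \<nu> i \<notin> neighbours G (\<nu> j))"
      using that edge by (auto simp: indegree_def neighbours_def)
    also have "\<dots> \<longleftrightarrow> neighbours G (\<nu> j) = {}"
      using neighbours_nodes[of "\<nu> j"] node_image by blast
    finally show ?thesis .
  qed
  then have H: "?H j = level j" if "j < n" for j
    using that by (auto simp: init_threshold_def level_def e_def encode_def Let_def)
  have "init_frame n m (iarr e 0) (iarr e 1) (iarr e 2) ?W (rarr e 1) 0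
      (e\<lparr>ireg := (ireg e)(3 := 1)\<rparr>) \<and> ireg e 2 = k \<and> ireg e 11 = 0"
    by (auto simp: init_frame_def init_threshold_def e_def encode_def Let_def m_def k_def)
  with triple_decider[of n m "iarr e 0" "iarr e 1" "iarr e 2" ?W "rarr e 1" k]
  obtain t s S where s: "exec decider e t s" "t \<le> time_bound n"
    and S: "adoptable n ?w ?H S" "S = {..<n} \<or> (\<forall>j. \<not> ready n ?w ?H S j)"
    and out: "ireg s 0 = (if (\<forall>j<n. iarr e 1 (j * m + k) = 1) \<and> S = {..<n} then 1 else 0)"
    unfolding triple_def by blast
  \<comment> \<open>The memory contents are exchanged for \<open>influence\<close> and
    \<open>level\<close>, which agree with them below \<open>n\<close>.\<close>
  have "reachable G p (const_network G tp) \<longleftrightarrow> (\<forall>v\<in>nodes G. tp \<in> p v) \<and> S = {..<n}"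
    using adoptable_cong[OF S(1) W H] S(2) ready_cong[OF W H adoptable_subset[OF S(1)]]
    by (intro reachable_const_iff) auto
  moreover have "(\<forall>j<n. iarr e 1 (j * m + k) = 1) \<longleftrightarrow> (\<forall>v\<in>nodes G. tp \<in> p v)"
    using M node node_image by metis
  ultimately have "ireg s 0 = (if reachable G p (const_network G tp) then 1 else 0)"
    using out by simp
  with s show "\<exists>t s. exec decider (encode G p tp \<nu> \<pi>) t s \<and> t \<le> time_bound n
      \<and> ireg s 0 = (if reachable G p (const_network G tp) then 1 else 0)"
    unfolding e_def by blast
qed

theorem theorem3:
  shows "\<exists>(c :: prog) (T :: nat \<Rightarrow> nat).
    decides_reachability_within c T \<and>
    (\<lambda>n. real (T n)) \<in> O(\<lambda>n. real n ^ 2)"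
  using decides_decider time_bound_bigo by blast

end
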